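(* Let $X$ be a first countable Hausdorff space with $|X| \leq \mathfrak{c}$. Then $X$ is $2^\omega$-partitionable if and only if $X$ is $2^\omega$-coverable.
   Context: $\mathfrak{c} = 2^{\aleph_0}$, and $2^\omega$ denotes the Cantor space. A space $X$ is $2^\omega$-partitionable if there is a partition of $X$ (a family of pairwise disjoint subsets with union $X$) each member of which, with the subspace topology, is homeomorphic to $2^\omega$. A space $X$ is $2^\omega$-coverable if there is a family of subsets of $X$ with union $X$, each member of which, with the subspace topology, is homeomorphic to $2^\omega$. *)

theory Defs
  imports "HOL-Analysis.Analysis" "HOL-Library.Equipollence" "HOL-Library.Disjoint_Sets"
begin

definition cantor_space :: "(nat \<Rightarrow> bool) topology" where
  "cantor_space = product_topology (\<lambda>_::nat. discrete_topology (UNIV :: bool set)) UNIV"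

(* The clause that excludes {} in partition_on is harmless: the Cantor space is nonempty. *)
definition cantor_partitionable :: "'a topology \<Rightarrow> bool" where
  "cantor_partitionable X \<longleftrightarrow>
     (\<exists>\<P>. partition_on (topspace X) \<P> \<and>
          (\<forall>C\<in>\<P>. subtopology X C homeomorphic_space cantor_space))"

definition cantor_coverable :: "'a topology \<Rightarrow> bool" where
  "cantor_coverable X \<longleftrightarrow>
     (\<exists>\<C>. \<Union>\<C> = topspace X \<and>
          (\<forall>C\<in>\<C>. subtopology X C homeomorphic_space cantor_space))"

end

theory Submission
  imports Defs
begin

text \<open>Take a maximal disjoint family \<open>\<K>\<close> of Cantor sets in \<open>X\<close>, and let \<open>R\<close> be the set of points
  that it misses. As \<open>X\<close> is coverable, every neighbourhood of a point of \<open>R\<close> contains a Cantor set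
  and so, by maximality, meets a member of \<open>\<K>\<close>. Split every \<open>K \<in> \<K>\<close> into continuum many Cantor
  sets, the fibres of the first projection of \<open>K \<cong> 2\<^sup>\<omega> \<times> 2\<^sup>\<omega>\<close>. An open set that meets \<open>K\<close> contains
  a clopen piece of continuum many of these fibres. Since \<open>|R| \<le> |2\<^sup>\<omega>|\<close>, one can therefore assign to
  each \<open>x \<in> R\<close> a sequence of such pieces converging to \<open>x\<close> in such a way that no fibre is used
  twice. A point \<open>x \<in> R\<close> together with its pieces is a Cantor set, and what is left of every fibre
  is a finite disjoint union of Cantor sets.\<close>

section \<open>The Cantor space\<close>

lemma topspace_cantor_space [simp]: "topspace cantor_space = UNIV"
  by (simp add: cantor_space_def)

lemma compact_space_cantor_space: "compact_space cantor_space"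
  by (simp add: cantor_space_def compact_space_product_topology compact_space_discrete_topology)

lemma continuous_map_into_cantor_space:
  "continuous_map X cantor_space f \<longleftrightarrow>
     (\<forall>i. continuous_map X (discrete_topology UNIV) (\<lambda>x. f x i))"
  by (simp add: cantor_space_def continuous_map_componentwise_UNIV)

lemma continuous_map_cantor_space_coordinate:
  "continuous_map cantor_space (discrete_topology UNIV) (\<lambda>z. z i)"
  unfolding cantor_space_def by (rule continuous_map_product_projection) simp

lemma openin_cantor_space_cylinder:
  "openin cantor_space {z. \<forall>i<N::nat. z i = a i}"
proof -
  have "openin cantor_space {z \<in> topspace cantor_space. z i \<in> {a i}}" for i
    by (rule openin_continuous_map_preimage[OF continuous_map_cantor_space_coordinate]) simp
  then have "openin cantor_space {z. z i = a i}" for i by simp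
  moreover have "{z. \<forall>i<N. z i = a i} = (\<Inter>i\<in>{..<N}. {z. z i = a i}) \<inter> topspace cantor_space"
    by auto
  ultimately show ?thesis
    by (metis (no_types, lifting) finite_lessThan openin_INT)
qed

text \<open>A basic open box of the product restricts only finitely many coordinates, and
  \<open>N\<close> is a bound for these.\<close>

lemma openin_cantor_space_contains_cylinder:
  assumes "openin cantor_space W" "a \<in> W"
  obtains N where "\<And>z. (\<And>i. i < N \<Longrightarrow> z i = a i) \<Longrightarrow> z \<in> W"
proof -
  obtain S where S: "a \<in> (\<Pi>\<^sub>E i\<in>UNIV. S i)" "finite {i. S i \<noteq> UNIV}" "(\<Pi>\<^sub>E i\<in>UNIV. S i) \<subseteq> W"
    using product_topology_open_contains_basis[OF assms(1)[unfolded cantor_space_def] assms(2)]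
    by auto
  obtain N where N: "\<And>i. S i \<noteq> UNIV \<Longrightarrow> i < N"
    using S(2) by (auto simp: finite_nat_set_iff_bounded)
  have "z \<in> W" if "\<And>i. i < N \<Longrightarrow> z i = a i" for z
  proof -
    have "z i \<in> S i" for i
      using that[of i] N[of i] S(1) by (cases "S i = UNIV") (auto simp: PiE_iff)
    then show ?thesis using S(3) by (auto simp: PiE_iff)
  qed
  then show thesis by (rule that)
qed

text \<open>Cylinders form a base, so continuity at \<open>a\<close> means that finitely many bits
  of the argument decide membership in \<open>V\<close>. Continuity is handled in this form when
  maps are glued and cylinders are fitted into open sets.\<close>

lemma continuous_map_from_cantor_space:
  "continuous_map cantor_space X g \<longleftrightarrow>
     range g \<subseteq> topspace X \<and>
     (\<forall>a V. openin X V \<longrightarrow> g a \<in> V \<longrightarrow> (\<exists>N. \<forall>z. (\<forall>i<N. z i = a i) \<longrightarrow> g z \<in> V))"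
    (is "?L \<longleftrightarrow> ?R")
proof
  assume g: ?L
  have "\<exists>N. \<forall>z. (\<forall>i<N. z i = a i) \<longrightarrow> g z \<in> V" if V: "openin X V" "g a \<in> V" for a V
  proof -
    have "openin cantor_space {z. g z \<in> V}"
      using openin_continuous_map_preimage[OF g V(1)] by simp
    then obtain N where "\<And>z. (\<And>i. i < N \<Longrightarrow> z i = a i) \<Longrightarrow> z \<in> {z. g z \<in> V}"
      using V(2) openin_cantor_space_contains_cylinder[of "{z. g z \<in> V}" a] by blast
    then show ?thesis by blast
  qed
  then show ?R using continuous_map_image_subset_topspace[OF g] by auto
next
  assume R: ?R
  have "openin cantor_space {z. g z \<in> V}" if V: "openin X V" for V
  proof (subst openin_subopen, intro ballI)
    fix a assume "a \<in> {z. g z \<in> V}"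
    then obtain N where N: "\<forall>z. (\<forall>i<N. z i = a i) \<longrightarrow> g z \<in> V"
      using R V by blast
    show "\<exists>T. openin cantor_space T \<and> a \<in> T \<and> T \<subseteq> {z. g z \<in> V}"
      by (rule exI[of _ "{z. \<forall>i<N. z i = a i}"]) (use N openin_cantor_space_cylinder in auto)
  qed
  then show ?L using R by (auto simp: continuous_map_def)
qed

lemma continuous_map_from_cantor_spaceD:
  assumes "continuous_map cantor_space X g" "openin X V" "g a \<in> V"
  shows "\<exists>N. \<forall>z. (\<forall>i<N. z i = a i) \<longrightarrow> g z \<in> V"
  using assms unfolding continuous_map_from_cantor_space by simp

section \<open>Cantor sets in a Hausdorff space\<close>

text \<open>Only a continuous injection is demanded, which is easy to compose and to glue; in a
  Hausdorff space it is automatically a homeomorphism onto \<open>C\<close>.\<close>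

definition cantor_image :: "'a topology \<Rightarrow> 'a set \<Rightarrow> bool" where
  "cantor_image X C \<longleftrightarrow> (\<exists>g. continuous_map cantor_space X g \<and> inj g \<and> range g = C)"

lemma cantor_imageI: "continuous_map cantor_space X g \<Longrightarrow> inj g \<Longrightarrow> cantor_image X (range g)"
  by (auto simp: cantor_image_def)

lemma cantor_image_subset: "cantor_image X C \<Longrightarrow> C \<subseteq> topspace X"
  unfolding cantor_image_def using continuous_map_image_subset_topspace by fastforce

lemma cantor_image_nonempty: "cantor_image X C \<Longrightarrow> C \<noteq> {}"
  by (auto simp: cantor_image_def)

text \<open>A continuous injection of a compact space into a Hausdorff space is a homeomorphism onto
  its image.\<close>

lemma cantor_image_iff_homeomorphic:
  assumes "Hausdorff_space X" "C \<subseteq> topspace X"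
  shows "cantor_image X C \<longleftrightarrow> subtopology X C homeomorphic_space cantor_space"
proof
  assume "cantor_image X C"
  then obtain g where g: "continuous_map cantor_space X g" "inj g" "range g = C"
    by (auto simp: cantor_image_def)
  have "homeomorphic_map cantor_space (subtopology X C) g"
    using g assms compact_space_cantor_space
    by (intro continuous_imp_homeomorphic_map)
      (auto simp: continuous_map_in_subtopology Hausdorff_space_subtopology)
  then show "subtopology X C homeomorphic_space cantor_space"
    using homeomorphic_map_imp_homeomorphic_space homeomorphic_space_sym by blast
next
  assume "subtopology X C homeomorphic_space cantor_space"
  then obtain g where "homeomorphic_map cantor_space (subtopology X C) g"
    using homeomorphic_space homeomorphic_space_sym by blast
  then have "continuous_map cantor_space X g" "inj g" "range g = C"
    using assms(2)
    by (auto simp: homeomorphic_eq_everything_map continuous_map_in_subtopology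
        dest!: homeomorphic_imp_surjective_map)
  then show "cantor_image X C" by (auto simp: cantor_image_def)
qed

text \<open>Relative to an arbitrary set \<open>S\<close>, so that parts of the space can be
  partitioned separately and then reassembled.\<close>

definition cantor_partition_on :: "'a topology \<Rightarrow> 'a set \<Rightarrow> bool" where
  "cantor_partition_on X S \<longleftrightarrow> (\<exists>\<P>. partition_on S \<P> \<and> (\<forall>C\<in>\<P>. cantor_image X C))"

lemma cantor_partition_on_empty: "cantor_partition_on X {}"
  by (auto simp: cantor_partition_on_def partition_on_def)

lemma cantor_image_imp_partition_on: "cantor_image X C \<Longrightarrow> cantor_partition_on X C"
  unfolding cantor_partition_on_def
  by (rule exI[of _ "{C}"]) (auto simp: partition_on_def dest: cantor_image_nonempty)

lemma cantor_partition_on_UN: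
  assumes dis: "disjoint_family_on S I" and part: "\<And>i. i \<in> I \<Longrightarrow> cantor_partition_on X (S i)"
  shows "cantor_partition_on X (\<Union>i\<in>I. S i)"
proof -
  obtain P where P: "\<And>i. i \<in> I \<Longrightarrow> partition_on (S i) (P i)"
      "\<And>i C. i \<in> I \<Longrightarrow> C \<in> P i \<Longrightarrow> cantor_image X C"
    using part unfolding cantor_partition_on_def by metis
  have "partition_on (\<Union>i\<in>I. S i) (\<Union>i\<in>I. P i)"
  proof (rule partition_onI)
    have "S i = \<Union> (P i)" if "i \<in> I" for i
      using P(1)[OF that] by (rule partition_onD1)
    then show "\<Union> (\<Union>i\<in>I. P i) = (\<Union>i\<in>I. S i)" by auto
    show "{} \<notin> (\<Union>i\<in>I. P i)"
      using P(1) by (auto simp: partition_on_def)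
    fix p q assume "p \<in> (\<Union>i\<in>I. P i)" "q \<in> (\<Union>i\<in>I. P i)" "p \<noteq> q"
    then obtain i j where ij: "i \<in> I" "p \<in> P i" "j \<in> I" "q \<in> P j" by auto
    show "disjnt p q"
    proof (cases "i = j")
      case True
      then show ?thesis
        using P(1)[of i] ij \<open>p \<noteq> q\<close> by (auto simp: partition_on_def disjoint_def disjnt_def)
    next
      case False
      then have "S i \<inter> S j = {}" using dis ij by (auto simp: disjoint_family_on_def)
      moreover have "p \<subseteq> S i" "q \<subseteq> S j" using P(1) ij by (auto simp: partition_on_def)
      ultimately show ?thesis by (auto simp: disjnt_def)
    qed
  qed
  with P(2) show ?thesis unfolding cantor_partition_on_def by blast
qed

lemma cantor_partition_on_Un:
  assumes "cantor_partition_on X S" "cantor_partition_on X T" "S \<inter> T = {}"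
  shows "cantor_partition_on X (S \<union> T)"
proof -
  have "cantor_partition_on X (\<Union>b\<in>UNIV. if b then S else T)"
    by (rule cantor_partition_on_UN) (use assms in \<open>auto simp: disjoint_family_on_def\<close>)
  moreover have "(\<Union>b\<in>UNIV. if b then S else T) = S \<union> T" by (auto split: if_splits)
  ultimately show ?thesis by simp
qed

text \<open>Meant for fibres \<open>S i\<close> from which cylinders \<open>P p\<close> are cut out.
  Since \<open>\<sigma>\<close> is injective, each fibre loses at most one cylinder, so what is left
  of it is covered by \<open>part\<close> or by \<open>diff\<close>.\<close>

lemma cantor_partition_on_UN_minus:
  assumes dis: "disjoint_family_on S I"
    and inj: "inj_on \<sigma> J" "\<sigma> ` J \<subseteq> I"
    and sub: "\<And>p. p \<in> J \<Longrightarrow> P p \<subseteq> S (\<sigma> p)"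
    and part: "\<And>i. i \<in> I \<Longrightarrow> cantor_partition_on X (S i)"
    and diff: "\<And>p. p \<in> J \<Longrightarrow> cantor_partition_on X (S (\<sigma> p) - P p)"
  shows "cantor_partition_on X ((\<Union>i\<in>I. S i) - (\<Union>p\<in>J. P p))"
proof -
  have "cantor_partition_on X (\<Union>i\<in>I. S i - (\<Union>p\<in>J. P p))"
  proof (rule cantor_partition_on_UN)
    show "disjoint_family_on (\<lambda>i. S i - (\<Union>p\<in>J. P p)) I"
      using dis by (auto simp: disjoint_family_on_def)
    fix i assume i: "i \<in> I"
    have off: "S i \<inter> P p = {}" if "p \<in> J" "\<sigma> p \<noteq> i" for p
      using dis i that sub[of p] inj(2) by (fastforce simp: disjoint_family_on_def)
    show "cantor_partition_on X (S i - (\<Union>p\<in>J. P p))"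
    proof (cases "i \<in> \<sigma> ` J")
      case False
      then have "S i - (\<Union>p\<in>J. P p) = S i" using off by blast
      with part[OF i] show ?thesis by simp
    next
      case True
      then obtain p where p: "p \<in> J" "i = \<sigma> p" by auto
      have "S i \<inter> P q = {}" if "q \<in> J" "q \<noteq> p" for q
        using off[of q] that p inj(1) by (auto dest: inj_onD)
      then have "S i - (\<Union>p\<in>J. P p) = S (\<sigma> p) - P p" using p by blast
      with diff[OF p(1)] show ?thesis by simp
    qed
  qed
  moreover have "(\<Union>i\<in>I. S i - (\<Union>p\<in>J. P p)) = (\<Union>i\<in>I. S i) - (\<Union>p\<in>J. P p)" by blast
  ultimately show ?thesis by simp
qed

lemma cantor_partitionable_iff:
  assumes "Hausdorff_space X"
  shows "cantor_partitionable X \<longleftrightarrow> cantor_partition_on X (topspace X)"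
proof -
  have "(\<forall>C\<in>\<P>. subtopology X C homeomorphic_space cantor_space) \<longleftrightarrow> (\<forall>C\<in>\<P>. cantor_image X C)"
    if "partition_on (topspace X) \<P>" for \<P>
  proof (rule ball_cong[OF refl])
    fix C assume "C \<in> \<P>"
    then have "C \<subseteq> topspace X" using partition_onD1[OF that] by auto
    then show "subtopology X C homeomorphic_space cantor_space \<longleftrightarrow> cantor_image X C"
      using cantor_image_iff_homeomorphic[OF assms] by blast
  qed
  then show ?thesis
    unfolding cantor_partitionable_def cantor_partition_on_def by blast
qed

text \<open>If any cover by Cantor sets exists, the family of all Cantor sets is one.\<close>

lemma cantor_coverable_iff:
  assumes "Hausdorff_space X"
  shows "cantor_coverable X \<longleftrightarrow> (\<forall>x\<in>topspace X. \<exists>C. cantor_image X C \<and> x \<in> C)" (is "?L \<longleftrightarrow> ?R")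
proof
  assume ?L
  then show ?R
    unfolding cantor_coverable_def
    using cantor_image_iff_homeomorphic[OF assms] by (metis Sup_upper UnionE)
next
  assume ?R
  then have "\<Union>{C. cantor_image X C} = topspace X"
    using cantor_image_subset by blast
  then show ?L
    unfolding cantor_coverable_def
    using cantor_image_iff_homeomorphic[OF assms] cantor_image_subset by (metis mem_Collect_eq)
qed

section \<open>Splitting a Cantor set into fibres and cylinders\<close>

text \<open>The even coordinates select a fibre of a map of the Cantor space onto itself; the odd ones
  are coordinates within that fibre.\<close>

definition fibre_cyl :: "(nat \<Rightarrow> bool) \<Rightarrow> (nat \<Rightarrow> bool) \<Rightarrow> nat \<Rightarrow> (nat \<Rightarrow> bool) set" where
  "fibre_cyl t w N = {z. (\<forall>i. z (2*i) = t i) \<and> (\<forall>i<N. z (2*i+1) = w i)}"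

lemma cantor_image_compose:
  assumes "continuous_map cantor_space X k" "inj k" "cantor_image cantor_space C"
  shows "cantor_image X (k ` C)"
proof -
  obtain e where e: "continuous_map cantor_space cantor_space e" "inj e" "range e = C"
    using assms(3) by (auto simp: cantor_image_def)
  have "cantor_image X (range (k \<circ> e))"
    using continuous_map_compose[OF e(1) assms(1)] inj_compose[OF assms(2) e(2)]
    by (rule cantor_imageI)
  then show ?thesis by (simp add: image_comp e(3) [symmetric])
qed

lemma cantor_image_fibre_cyl: "cantor_image cantor_space (fibre_cyl t w N)"
proof -
  \<comment> \<open>The even bits spell \<open>t\<close>, the first \<open>N\<close> odd bits spell
    \<open>w\<close>, and the remaining odd bits carry \<open>z\<close> in order; bit
    \<open>j\<close> of \<open>z\<close> sits at \<open>2 * (j + N) + 1\<close>.\<close>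
  define e where "e = (\<lambda>z i. if even i then t (i div 2) else
      if i div 2 < N then w (i div 2) else z (i div 2 - N) :: bool)"
  have "continuous_map cantor_space cantor_space e"
    unfolding continuous_map_into_cantor_space
  proof
    fix i
    show "continuous_map cantor_space (discrete_topology UNIV) (\<lambda>z. e z i)"
      using continuous_map_cantor_space_coordinate by (simp add: e_def)
  qed
  moreover have "inj e"
  proof (rule injI, rule ext)
    fix z z' j assume "e z = e z'"
    then have "e z (2 * (j + N) + 1) = e z' (2 * (j + N) + 1)" by simp
    then show "z j = z' j" by (simp add: e_def)
  qed
  moreover have "range e = fibre_cyl t w N"
  proof
    show "range e \<subseteq> fibre_cyl t w N" by (auto simp: e_def fibre_cyl_def)
    show "fibre_cyl t w N \<subseteq> range e"
    proof
      fix u assume u: "u \<in> fibre_cyl t w N"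
      have "u i = e (\<lambda>j. u (2 * (j + N) + 1)) i" for i
      proof (cases "even i")
        case True
        then show ?thesis using u by (auto simp: e_def fibre_cyl_def elim!: evenE)
      next
        case False
        then obtain m where m: "i = 2 * m + 1" by (auto elim!: oddE)
        show ?thesis
        proof (cases "m < N")
          case True
          then show ?thesis using u m by (simp add: e_def fibre_cyl_def)
        next
          case False
          then obtain d where "m = N + d" using le_Suc_ex not_le by blast
          then show ?thesis using m by (simp add: e_def add.commute)
        qed
      qed
      then have "u = e (\<lambda>j. u (2 * (j + N) + 1))" by blast
      then show "u \<in> range e" by blast
    qed
  qed
  ultimately show ?thesis by (auto simp: cantor_image_def)
qed

text \<open>Each bit added to the prescribed word splits the current cylinder into two halves; the
  discarded halves are Cantor sets, and \<open>N\<close> of them make up the difference.\<close>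

lemma cantor_partition_on_fibre_minus_cyl:
  assumes k: "continuous_map cantor_space X k" "inj k"
  shows "cantor_partition_on X (k ` fibre_cyl t w 0 - k ` fibre_cyl t w N)"
proof (induction N)
  case 0
  show ?case by (simp add: cantor_partition_on_empty)
next
  case (Suc N)
  \<comment> \<open>The half discarded at stage \<open>N\<close>: agreement with \<open>w\<close> on
    the first \<open>N\<close> odd bits and disagreement at the next one.\<close>
  let ?C = "fibre_cyl t (w(N := \<not> w N)) (Suc N)"
  have "fibre_cyl t w 0 - fibre_cyl t w (Suc N) = (fibre_cyl t w 0 - fibre_cyl t w N) \<union> ?C"
    by (auto simp: fibre_cyl_def less_Suc_eq)
  then have "k ` fibre_cyl t w 0 - k ` fibre_cyl t w (Suc N) =
      (k ` fibre_cyl t w 0 - k ` fibre_cyl t w N) \<union> k ` ?C"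
    by (simp add: image_set_diff[OF k(2), symmetric] image_Un)
  moreover have "(k ` fibre_cyl t w 0 - k ` fibre_cyl t w N) \<inter> k ` ?C = {}"
  proof -
    have "(fibre_cyl t w 0 - fibre_cyl t w N) \<inter> ?C = {}"
      by (auto simp: fibre_cyl_def)
    then show ?thesis
      by (metis image_Int[OF k(2)] image_set_diff[OF k(2)] image_empty)
  qed
  moreover have "cantor_partition_on X (k ` ?C)"
    by (intro cantor_image_imp_partition_on cantor_image_compose k cantor_image_fibre_cyl)
  ultimately show ?case using Suc cantor_partition_on_Un by metis
qed

text \<open>A short enough neighbourhood of the code of \<open>x\<close> is mapped into
  \<open>U\<close>, and it contains a cylinder of a fibre. This lets maximality of a disjoint family
  be tested inside arbitrary neighbourhoods of \<open>x\<close>.\<close>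

lemma cantor_image_in_open:
  assumes "cantor_image X C" "x \<in> C" "openin X U" "x \<in> U"
  obtains D where "cantor_image X D" "D \<subseteq> C \<inter> U"
proof -
  obtain g where g: "continuous_map cantor_space X g" "inj g" "range g = C"
    using assms(1) by (auto simp: cantor_image_def)
  obtain a where a: "x = g a" using assms(2) g(3) by auto
  have "g a \<in> U" using assms(4) a by simp
  then obtain N where N: "\<forall>z. (\<forall>i<N. z i = a i) \<longrightarrow> g z \<in> U"
    using continuous_map_from_cantor_spaceD[OF g(1) assms(3)] by presburger
  \<comment> \<open>All even bits and the first \<open>N\<close> odd bits are those of
    \<open>a\<close>, which covers every index below \<open>N\<close>.\<close>
  let ?F = "fibre_cyl (\<lambda>i. a (2*i)) (\<lambda>i. a (2*i+1)) N"
  have "g z \<in> U" if "z \<in> ?F" for z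
  proof (rule N[rule_format])
    fix i assume "i < N"
    with that show "z i = a i"
      by (cases "even i") (auto simp: fibre_cyl_def elim!: evenE oddE)
  qed
  then have "g ` ?F \<subseteq> C \<inter> U" using g(3) by auto
  with cantor_image_compose[OF g(1,2) cantor_image_fibre_cyl] show thesis by (rule that)
qed

section \<open>Gluing a sequence of Cantor sets at a limit point\<close>

text \<open>The Cantor space without the zero sequence is a disjoint union of clopen copies of
  itself, one for each position of the first 1, and these shrink to the zero sequence just as the
  \<open>P n\<close> shrink to \<open>x\<close>.\<close>

lemma cantor_image_insert_UN:
  assumes x: "x \<in> topspace X"
    and P: "\<And>n::nat. cantor_image X (P n)" "disjoint_family P" "\<And>n. x \<notin> P n"
    and lim: "\<And>U. openin X U \<Longrightarrow> x \<in> U \<Longrightarrow> \<exists>n0. \<forall>n\<ge>n0. P n \<subseteq> U"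
  shows "cantor_image X (insert x (\<Union>n. P n))"
proof -
  obtain p where p: "\<And>n. continuous_map cantor_space X (p n)" "\<And>n. inj (p n)"
      "\<And>n. range (p n) = P n"
    using P(1) unfolding cantor_image_def by metis
  \<comment> \<open>\<open>l z\<close> is the position of the first 1, and \<open>sh n z\<close>
    drops the first \<open>n + 1\<close> bits. For the zero sequence \<open>l\<close> has no
    specified value; \<open>g\<close> treats that case separately.\<close>
  define l where "l = (\<lambda>z::nat\<Rightarrow>bool. LEAST n. z n)"
  define sh where "sh = (\<lambda>n (z::nat\<Rightarrow>bool) i. z (i + Suc n))"
  \<comment> \<open>\<open>0\<^sup>\<infinity>\<close> goes to \<open>x\<close>, and \<open>0\<^sup>n 1 z\<close> goes to \<open>p n z\<close>.\<close>
  define g where "g = (\<lambda>z. if \<exists>n. z n then p (l z) (sh (l z) z) else x)"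
  have lz: "l z = n" if "z n" "\<forall>i<n. \<not> z i" for z n
    unfolding l_def by (rule Least_equality[where P = z]) (use that not_le in auto)
  have l: "z (l z)" if "\<exists>n. z n" for z
    unfolding l_def using that by (rule LeastI_ex[where P = z])
  have l_less: "\<not> z i" if "i < l z" for z i
    using not_less_Least[of i z] that unfolding l_def by simp
  have g0: "g z = x" if "\<not> (\<exists>n. z n)" for z
    unfolding g_def using that by (rule if_not_P)
  have g1: "g z = p (l z) (sh (l z) z)" if "\<exists>n. z n" for z
    unfolding g_def using that by (rule if_P)
  have gin: "g z \<in> P (l z)" if "\<exists>n. z n" for z
    unfolding g1[OF that] using p(3) by blast
  have "continuous_map cantor_space X g"
    unfolding continuous_map_from_cantor_space
  proof (intro conjI allI impI)
    show "range g \<subseteq> topspace X"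
      using gin g0 cantor_image_subset[OF P(1)] x by (metis image_subsetI subsetD)
    fix a V assume V: "openin X V" "g a \<in> V"
    show "\<exists>N. \<forall>z. (\<forall>i<N. z i = a i) \<longrightarrow> g z \<in> V"
    proof (cases "\<exists>n. a n")
      case True
      then have "p (l a) (sh (l a) a) \<in> V" using V g1 by simp
      then obtain N where N: "\<forall>z. (\<forall>i<N. z i = sh (l a) a i) \<longrightarrow> p (l a) z \<in> V"
        using continuous_map_from_cantor_spaceD[OF p(1) V(1)] by presburger
      \<comment> \<open>The first \<open>Suc (l a)\<close> bits fix the block, and the next
        \<open>N\<close> bits control the argument of \<open>p (l a)\<close>.\<close>
      have "g z \<in> V" if z: "\<forall>i < N + Suc (l a). z i = a i" for z
      proof -
        have "z (l a)" "\<forall>i<l a. \<not> z i" using z l[OF True] l_less[of _ a] by auto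
        then have "g z = p (l a) (sh (l a) z)" using lz[of z "l a"] g1[of z] by metis
        moreover have "p (l a) (sh (l a) z) \<in> V"
          by (rule N[rule_format]) (use z in \<open>auto simp: sh_def\<close>)
        ultimately show ?thesis by simp
      qed
      then show ?thesis by blast
    next
      case False
      then have "x \<in> V" using V g0 by simp
      then obtain n0 where n0: "\<And>n. n \<ge> n0 \<Longrightarrow> P n \<subseteq> V" using lim V by blast
      \<comment> \<open>Here \<open>a\<close> is the zero sequence, so agreement on
        \<open>n0\<close> bits pushes the first 1 of \<open>z\<close>, if there is one, to position
        \<open>n0\<close> or later.\<close>
      have "g z \<in> V" if z: "\<forall>i < n0. z i = a i" for z
      proof (cases "\<exists>n. z n")
        case True
        then have "l z \<ge> n0" using l[OF True] z False not_le by blast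
        then show ?thesis using gin[OF True] n0 by blast
      next
        case False
        then show ?thesis using \<open>x \<in> V\<close> g0 by simp
      qed
      then show ?thesis by blast
    qed
  qed
  moreover have "inj g"
  proof (rule injI)
    fix y z assume eq: "g y = g z"
    show "y = z"
    proof (cases "(\<exists>n. y n) \<and> (\<exists>n. z n)")
      case True
      \<comment> \<open>Disjointness of the blocks recovers the position of the first 1, and
        injectivity of \<open>p\<close> then recovers the tail.\<close>
      then have "g y \<in> P (l y) \<inter> P (l z)" using gin[of y] gin[of z] eq by simp
      then have ll: "l y = l z" using P(2) by (auto simp: disjoint_family_on_def)
      then have "p (l y) (sh (l y) y) = p (l y) (sh (l y) z)"
        using True eq g1 by metis
      then have sh: "sh (l y) y = sh (l y) z" using p(2) by (simp add: inj_eq)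
      show "y = z"
      proof
        fix i
        consider "i < l y" | "i = l y" | j where "i = j + Suc (l y)"
          using less_imp_Suc_add[of "l y" i] by (metis add.commute add_Suc_right linorder_neqE_nat)
        then show "y i = z i"
          using l[of y] l[of z] l_less[of i y] l_less[of i z] ll True
            fun_cong[OF sh, unfolded sh_def] by cases auto
      qed
    next
      case False
      then have "(\<forall>n. \<not> y n) \<and> (\<forall>n. \<not> z n)"
        using gin[of y] gin[of z] eq P(3) by (metis g0)
      then show ?thesis by (simp add: fun_eq_iff)
    qed
  qed
  moreover have "range g = insert x (\<Union>n. P n)"
  proof
    show "range g \<subseteq> insert x (\<Union>n. P n)"
    proof (rule image_subsetI)
      show "g z \<in> insert x (\<Union>n. P n)" for z
        by (cases "\<exists>n. z n") (use gin[of z] g0[of z] in auto)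
    qed
    have "x = g (\<lambda>_. False)" by (simp add: g0)
    moreover have "u \<in> range g" if u: "u \<in> P n" for u n
    proof -
      obtain z where z: "u = p n z" using u p(3) by blast
      define y where "y = (\<lambda>i. if i < n then False else if i = n then True else z (i - Suc n))"
      have "l y = n" by (rule lz) (auto simp: y_def)
      moreover have "sh n y = z" by (auto simp: sh_def y_def)
      moreover have "\<exists>n. y n" by (auto simp: y_def)
      ultimately have "g y = u" by (simp add: g1 z)
      then show ?thesis by blast
    qed
    ultimately show "insert x (\<Union>n. P n) \<subseteq> range g" by blast
  qed
  ultimately show ?thesis unfolding cantor_image_def by blast
qed

text \<open>Intersecting initial segments of an enumerated local base makes it decreasing, so each
  neighbourhood contains all but finitely many of its members.\<close>

lemma first_countable_sequence:
  assumes "first_countable X" "x \<in> topspace X"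
  obtains B :: "nat \<Rightarrow> 'a set" where "\<And>n. openin X (B n)" "\<And>n. x \<in> B n"
    "\<And>U. openin X U \<Longrightarrow> x \<in> U \<Longrightarrow> \<exists>n0. \<forall>n\<ge>n0. B n \<subseteq> U"
proof -
  obtain \<B> where \<B>: "countable \<B>" "\<And>V. V \<in> \<B> \<Longrightarrow> openin X V"
      "\<And>U. openin X U \<Longrightarrow> x \<in> U \<Longrightarrow> \<exists>V\<in>\<B>. x \<in> V \<and> V \<subseteq> U"
    using assms unfolding first_countable_def by metis
  let ?\<B> = "{V \<in> \<B>. x \<in> V}"
  have "?\<B> \<noteq> {}" using \<B>(3)[of "topspace X"] assms(2) by auto
  moreover have "countable ?\<B>" using \<B>(1) by simp
  ultimately obtain e :: "nat \<Rightarrow> 'a set" where e: "range e = ?\<B>"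
    using range_from_nat_into by metis
  define B where "B = (\<lambda>n. \<Inter>i\<in>{..n}. e i)"
  have ei: "openin X (e i)" "x \<in> e i" for i using e \<B>(2) by auto
  show thesis
  proof
    show "openin X (B n)" for n
      unfolding B_def using ei by (intro openin_Inter) auto
    show "x \<in> B n" for n using ei by (simp add: B_def)
    fix U assume "openin X U" "x \<in> U"
    then obtain V where "V \<in> ?\<B>" "V \<subseteq> U" using \<B>(3) by blast
    then obtain i where "e i \<subseteq> U" using e by (metis rangeE)
    then show "\<exists>n0. \<forall>n\<ge>n0. B n \<subseteq> U" by (intro exI[of _ i]) (auto simp: B_def)
  qed
qed

section \<open>From coverings to partitions\<close>

text \<open>Zorn's lemma applies because two members of the union of a chain already lie in a common
  family of the chain. A Cantor set missing every member could be added to a maximal family.\<close>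

lemma maximal_disjoint_cantor_family:
  obtains \<K> where "disjoint \<K>" "\<And>K. K \<in> \<K> \<Longrightarrow> cantor_image X K"
    "\<And>C. cantor_image X C \<Longrightarrow> \<exists>K\<in>\<K>. K \<inter> C \<noteq> {}"
proof -
  let ?A = "{\<K>. disjoint \<K> \<and> (\<forall>K\<in>\<K>. cantor_image X K)}"
  have "\<exists>M\<in>?A. \<forall>\<L>\<in>?A. M \<subseteq> \<L> \<longrightarrow> \<L> = M"
  proof (rule Zorn_Lemma, intro ballI)
    fix c assume c: "c \<in> chains ?A"
    have "disjoint (\<Union>c)"
      unfolding disjoint_def
    proof (intro ballI impI)
      fix a b assume ab: "a \<in> \<Union>c" "b \<in> \<Union>c" "a \<noteq> b"
      then obtain \<K> where "\<K> \<in> c" "a \<in> \<K>" "b \<in> \<K>"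
        using chainsD[OF c] by blast
      moreover have "disjoint \<K>" using chainsD2[OF c] \<open>\<K> \<in> c\<close> by auto
      ultimately show "a \<inter> b = {}" using ab(3) by (auto simp: disjoint_def)
    qed
    then show "\<Union>c \<in> ?A" using chainsD2[OF c] by auto
  qed
  then obtain \<K> where K: "disjoint \<K>" "\<And>K. K \<in> \<K> \<Longrightarrow> cantor_image X K"
      "\<And>\<L>. \<L> \<in> ?A \<Longrightarrow> \<K> \<subseteq> \<L> \<Longrightarrow> \<L> = \<K>"
    by auto
  have "\<exists>K\<in>\<K>. K \<inter> C \<noteq> {}" if C: "cantor_image X C" for C
  proof (rule ccontr)
    assume "\<not> ?thesis"
    then have dis: "\<And>K. K \<in> \<K> \<Longrightarrow> K \<inter> C = {}" by blast
    then have "insert C \<K> \<in> ?A"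
      using K(1,2) C by (auto simp: disjoint_def)
    then have "C \<in> \<K>" using K(3)[of "insert C \<K>"] by auto
    with dis cantor_image_nonempty[OF C] show False by blast
  qed
  with K(1,2) show thesis by (rule that)
qed

text \<open>The injection spreads every bit of the code of \<open>p\<close> over infinitely many coordinates,
  so that changing finitely many of them, as needed to hit a given cylinder, loses nothing.\<close>

lemma inj_on_modify_finitely:
  fixes N :: "'b \<Rightarrow> nat" and y :: "'b \<Rightarrow> nat \<Rightarrow> bool"
  assumes "J \<lesssim> (UNIV :: (nat \<Rightarrow> bool) set)"
  obtains t :: "'b \<Rightarrow> nat \<Rightarrow> bool" where "inj_on t J" "\<And>p i. i < N p \<Longrightarrow> t p i = y p i"
proof -
  obtain f :: "'b \<Rightarrow> nat \<Rightarrow> bool" where f: "inj_on f J" using assms by (auto simp: lepoll_def)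
  define t where "t = (\<lambda>p i. if i < N p then y p i else f p (fst (prod_decode i)))"
  have "inj_on t J"
  proof (rule inj_onI)
    fix p q assume pq: "p \<in> J" "q \<in> J" "t p = t q"
    have "f p i = f q i" for i
    proof -
      \<comment> \<open>An index that carries bit \<open>i\<close> of the code and, since
        \<open>prod_encode\<close> dominates its second argument, lies beyond both modified
        prefixes.\<close>
      let ?m = "prod_encode (i, max (N p) (N q))"
      have "\<not> ?m < N p" "\<not> ?m < N q"
        using le_prod_encode_2[of "max (N p) (N q)" i] by linarith+
      then have "t p ?m = f p i" "t q ?m = f q i" by (simp_all add: t_def)
      then show ?thesis using pq(3) by simp
    qed
    then show "p = q" using f pq by (auto dest: inj_onD)
  qed
  then show thesis by (rule that) (simp add: t_def)
qed

text \<open>The even bits store the code of the point, and the odd bits store \<open>n\<close> as a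
  single 1 in place \<open>n\<close>.\<close>

lemma lepoll_times_nat_cantor:
  assumes "A \<lesssim> (UNIV :: (nat \<Rightarrow> bool) set)"
  shows "A \<times> (UNIV :: nat set) \<lesssim> (UNIV :: (nat \<Rightarrow> bool) set)"
proof -
  obtain f :: "'a \<Rightarrow> nat \<Rightarrow> bool" where f: "inj_on f A" using assms by (auto simp: lepoll_def)
  define h where "h = (\<lambda>(x, n::nat) i. if even i then f x (i div 2) else i div 2 = n)"
  have "inj_on h (A \<times> UNIV)"
  proof (rule inj_onI, clarify)
    fix x n x' n' assume xs: "x \<in> A" "x' \<in> A" and eq: "h (x, n) = h (x', n')"
    have "f x i = f x' i" for i using fun_cong[OF eq, of "2*i"] by (simp add: h_def)
    then have "x = x'" using f xs by (auto dest: inj_onD)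
    moreover have "n = n'" using fun_cong[OF eq, of "2*n+1"] by (simp add: h_def)
    ultimately show "x = x' \<and> n = n'" by simp
  qed
  then show ?thesis by (auto simp: lepoll_def)
qed

lemma cantor_coverable_imp_partition_on:
  fixes X :: "'a topology"
  assumes fc: "first_countable X"
    and card: "topspace X \<lesssim> (UNIV :: (nat \<Rightarrow> bool) set)"
    and cov: "\<And>x. x \<in> topspace X \<Longrightarrow> \<exists>C. cantor_image X C \<and> x \<in> C"
  shows "cantor_partition_on X (topspace X)"
proof -

  \<comment> \<open>The maximal family and small cylinders near the missed points\<close>
  obtain \<K> where \<K>: "disjoint \<K>" "\<And>K. K \<in> \<K> \<Longrightarrow> cantor_image X K"
      "\<And>C. cantor_image X C \<Longrightarrow> \<exists>K\<in>\<K>. K \<inter> C \<noteq> {}"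
    using maximal_disjoint_cantor_family[of X] by blast
  define R where "R = topspace X - \<Union>\<K>"
  \<comment> \<open>The pair \<open>(x, n)\<close> indexes the \<open>n\<close>-th piece of the
    sequence converging to \<open>x\<close>.\<close>
  define J where "J = R \<times> (UNIV :: nat set)"
  obtain k where k: "\<And>K. K \<in> \<K> \<Longrightarrow> continuous_map cantor_space X (k K)"
      "\<And>K. K \<in> \<K> \<Longrightarrow> inj (k K)" "\<And>K. K \<in> \<K> \<Longrightarrow> range (k K) = K"
    using \<K>(2) unfolding cantor_image_def by metis
  have "\<exists>B. (\<forall>n::nat. openin X (B n)) \<and> (\<forall>n. x \<in> B n) \<and>
      (\<forall>U. openin X U \<longrightarrow> x \<in> U \<longrightarrow> (\<exists>n0. \<forall>n\<ge>n0. B n \<subseteq> U))" if "x \<in> R" for x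
    using first_countable_sequence[OF fc, of x] that unfolding R_def by (metis DiffD1)
  then obtain B where B: "\<And>x n. x \<in> R \<Longrightarrow> openin X (B x (n::nat))" "\<And>x n. x \<in> R \<Longrightarrow> x \<in> B x n"
      "\<And>x U. x \<in> R \<Longrightarrow> openin X U \<Longrightarrow> x \<in> U \<Longrightarrow> \<exists>n0. \<forall>n\<ge>n0. B x n \<subseteq> U"
    by metis
  \<comment> \<open>The \<open>n\<close>-th neighbourhood of \<open>x\<close> contains a Cantor set,
    which by maximality meets some \<open>K\<close>; continuity of \<open>k K\<close> then yields a
    cylinder around a code \<open>y\<close> of a common point.\<close>
  have "\<exists>K y N. K \<in> \<K> \<and> (\<forall>z. (\<forall>i<N. z i = y i) \<longrightarrow> k K z \<in> B (fst p) (snd p))"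
    if p: "p \<in> J" for p
  proof -
    obtain x n where p: "p = (x, n)" "x \<in> R" using p by (auto simp: J_def)
    obtain C where "cantor_image X C" "x \<in> C" using cov p(2) by (auto simp: R_def)
    then obtain D where D: "cantor_image X D" "D \<subseteq> C \<inter> B x n"
      using cantor_image_in_open[OF _ _ B(1,2)[OF p(2)]] by metis
    then obtain K u where K: "K \<in> \<K>" "u \<in> K" "u \<in> B x n" using \<K>(3) by blast
    then obtain y where "k K y \<in> B x n" using k(3)[OF K(1)] by (metis rangeE)
    then have "\<exists>N. \<forall>z. (\<forall>i<N. z i = y i) \<longrightarrow> k K z \<in> B x n"
      by (rule continuous_map_from_cantor_spaceD[OF k(1)[OF K(1)] B(1)[OF p(2)]])
    with K(1) p(1) show ?thesis by (metis fst_conv snd_conv)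
  qed
  then obtain \<kappa> y N where pick: "\<And>p. p \<in> J \<Longrightarrow> \<kappa> p \<in> \<K>"
      "\<And>p z. p \<in> J \<Longrightarrow> (\<forall>i<N p. z i = y p i) \<Longrightarrow> k (\<kappa> p) z \<in> B (fst p) (snd p)"
    by metis

  \<comment> \<open>Distinct fibres for distinct pieces\<close>
  have "R \<lesssim> (UNIV :: (nat \<Rightarrow> bool) set)"
    by (rule lepoll_trans[OF subset_imp_lepoll card]) (simp add: R_def)
  then have "J \<lesssim> (UNIV :: (nat \<Rightarrow> bool) set)"
    unfolding J_def by (rule lepoll_times_nat_cantor)
  \<comment> \<open>Agreement with the even bits of \<open>y p\<close> below \<open>N p\<close>
    makes the fibre over \<open>t p\<close> meet the cylinder chosen for \<open>p\<close>.\<close>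
  then obtain t where t: "inj_on t J" "\<And>p i. i < N p \<Longrightarrow> t p i = y p (2*i)"
    using inj_on_modify_finitely[of J N "\<lambda>p i. y p (2*i)"] by blast
  \<comment> \<open>\<open>S (K, s)\<close> is the whole fibre over \<open>s\<close>: at length 0
    the word imposes no condition, so \<open>\<lambda>_. False\<close> is a dummy.\<close>
  define S where "S = (\<lambda>(K, s). k K ` fibre_cyl s (\<lambda>_. False) 0)"
  define P where "P = (\<lambda>p. k (\<kappa> p) ` fibre_cyl (t p) (\<lambda>i. y p (2*i+1)) (N p))"
  define \<sigma> where "\<sigma> = (\<lambda>p. (\<kappa> p, t p))"
  have fibre0: "fibre_cyl s w 0 = fibre_cyl s w' 0" for s w w'
    by (simp add: fibre_cyl_def)
  have US: "(\<Union>i\<in>\<K> \<times> UNIV. S i) = \<Union>\<K>"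
  proof -
    have "(\<Union>s. S (K, s)) = K" if "K \<in> \<K>" for K
    proof -
      have "(\<Union>s. fibre_cyl s (\<lambda>_. False) 0) = UNIV"
      proof -
        have "z \<in> fibre_cyl (\<lambda>i. z (2*i)) (\<lambda>_. False) 0" for z by (simp add: fibre_cyl_def)
        then show ?thesis by blast
      qed
      then have "(\<Union>s. S (K, s)) = range (k K)"
        by (simp add: S_def image_UN [symmetric])
      with k(3)[OF that] show ?thesis by simp
    qed
    then show ?thesis by blast
  qed
  have S_sub: "S (K, s) \<subseteq> K" if "K \<in> \<K>" for K s
    using k(3)[OF that] by (auto simp: S_def)
  have disS: "disjoint_family_on S (\<K> \<times> UNIV)"
    unfolding disjoint_family_on_def
  proof (intro ballI impI)
    fix i j assume "i \<in> \<K> \<times> (UNIV :: (nat \<Rightarrow> bool) set)" "j \<in> \<K> \<times> (UNIV :: (nat \<Rightarrow> bool) set)" "i \<noteq> j"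
    then obtain K s K' s' where ij: "i = (K, s)" "j = (K', s')"
        and K: "K \<in> \<K>" "K' \<in> \<K>" and ne: "K = K' \<Longrightarrow> s \<noteq> s'"
      by (cases i, cases j) auto
    have "S (K, s) \<inter> S (K', s') = {}"
    proof (cases "K = K'")
      case True
      then have "s \<noteq> s'" using ne by simp
      moreover have "s = s'"
        if "z \<in> fibre_cyl s (\<lambda>_. False) 0" "z \<in> fibre_cyl s' (\<lambda>_. False) 0" for z
        using that by (simp add: fibre_cyl_def fun_eq_iff)
      ultimately have "fibre_cyl s (\<lambda>_. False) 0 \<inter> fibre_cyl s' (\<lambda>_. False) 0 = {}"
        by blast
      then show ?thesis
        using True k(2)[OF K(1)] by (simp add: S_def image_Int [symmetric])
    next
      case False
      then have "K \<inter> K' = {}" using \<K>(1) K by (auto simp: disjoint_def)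
      then show ?thesis using S_sub[OF K(1)] S_sub[OF K(2)] by blast
    qed
    then show "S i \<inter> S j = {}" unfolding ij .
  qed
  \<comment> \<open>\<open>t\<close> alone separates the pairs, so the same \<open>K\<close> may
    serve many of them.\<close>
  have inj\<sigma>: "inj_on \<sigma> J" using t(1) by (simp add: \<sigma>_def inj_on_def)
  have \<sigma>: "\<sigma> ` J \<subseteq> \<K> \<times> UNIV" using pick(1) by (auto simp: \<sigma>_def)
  have PS: "P p \<subseteq> S (\<sigma> p)" for p
    by (auto simp: P_def S_def \<sigma>_def fibre_cyl_def)
  have P_image: "cantor_image X (P p)" if "p \<in> J" for p
    unfolding P_def using pick(1)[OF that] k by (intro cantor_image_compose cantor_image_fibre_cyl)
  have disP: "disjoint_family_on P J"
    unfolding disjoint_family_on_def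
  proof (intro ballI impI)
    fix p q assume pq: "p \<in> J" "q \<in> J" "p \<noteq> q"
    then have "\<sigma> p \<noteq> \<sigma> q" using inj\<sigma> by (auto dest: inj_onD)
    then have "S (\<sigma> p) \<inter> S (\<sigma> q) = {}"
      using disS \<sigma> pq unfolding disjoint_family_on_def by blast
    then show "P p \<inter> P q = {}" using PS[of p] PS[of q] by blast
  qed
  have P_B: "P p \<subseteq> B (fst p) (snd p)" if "p \<in> J" for p
  proof -
    \<comment> \<open>Below \<open>N p\<close> the even bits of \<open>z\<close> agree with
      \<open>y p\<close> by the choice of \<open>t\<close>, the odd ones by the cylinder.\<close>
    have "k (\<kappa> p) z \<in> B (fst p) (snd p)"
      if z: "z \<in> fibre_cyl (t p) (\<lambda>i. y p (2*i+1)) (N p)" for z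
    proof (rule pick(2)[OF \<open>p \<in> J\<close>], intro allI impI)
      fix i assume "i < N p"
      with z t(2)[of _ p] show "z i = y p i"
        by (cases "even i") (auto simp: fibre_cyl_def elim!: evenE oddE)
    qed
    then show ?thesis by (auto simp: P_def)
  qed
  have PK: "P p \<subseteq> \<Union>\<K>" if "p \<in> J" for p
  proof -
    have "\<sigma> p \<in> \<K> \<times> UNIV" using \<sigma> imageI[OF that] by (rule subsetD)
    then have "S (\<sigma> p) \<subseteq> \<Union>\<K>" unfolding US [symmetric] by (rule UN_upper)
    with PS show ?thesis by (rule subset_trans)
  qed
  have rest: "cantor_partition_on X (\<Union>\<K> - (\<Union>p\<in>J. P p))"
    unfolding US [symmetric]
  proof (rule cantor_partition_on_UN_minus[OF disS inj\<sigma> \<sigma> PS])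
    show "cantor_partition_on X (S i)" if "i \<in> \<K> \<times> UNIV" for i
    proof -
      obtain K s where "i = (K, s)" "K \<in> \<K>" using \<open>i \<in> \<K> \<times> UNIV\<close> by blast
      then show ?thesis
        by (simp add: S_def cantor_image_imp_partition_on cantor_image_compose
            cantor_image_fibre_cyl k(1,2))
    qed
    show "cantor_partition_on X (S (\<sigma> p) - P p)" if "p \<in> J" for p
      using cantor_partition_on_fibre_minus_cyl[OF k(1,2), OF pick(1) pick(1), OF that that]
      by (simp add: S_def P_def \<sigma>_def fibre0[of _ "\<lambda>_. False" "\<lambda>i. y p (2*i+1)"])
  qed

  \<comment> \<open>Cantor sets through the missed points\<close>
  define L where "L = (\<lambda>x. insert x (\<Union>n. P (x, n)))"
  have L_image: "cantor_image X (L x)" if x: "x \<in> R" for x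
    unfolding L_def
  proof (rule cantor_image_insert_UN)
    have xJ: "(x, n) \<in> J" for n using x by (simp add: J_def)
    show "x \<in> topspace X" using x by (simp add: R_def)
    show "cantor_image X (P (x, n))" for n using P_image xJ .
    show "disjoint_family (\<lambda>n. P (x, n))"
      using disP xJ by (simp add: disjoint_family_on_def)
    show "x \<notin> P (x, n)" for n using PK[OF xJ[of n]] x by (auto simp: R_def)
    fix U assume "openin X U" "x \<in> U"
    then obtain n0 where "\<forall>n\<ge>n0. B x n \<subseteq> U" using B(3) x by blast
    then show "\<exists>n0. \<forall>n\<ge>n0. P (x, n) \<subseteq> U" using P_B[OF xJ] by fastforce
  qed
  have disL: "disjoint_family_on L R"
    unfolding disjoint_family_on_def
  proof (intro ballI impI)
    fix x x' assume x: "x \<in> R" "x' \<in> R" "x \<noteq> x'"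
    then have J: "(x, n) \<in> J" "(x', n) \<in> J" for n by (auto simp: J_def)
    then have "P (x, n) \<inter> P (x', n') = {}" for n n'
      using disP x(3) by (auto simp: disjoint_family_on_def)
    \<comment> \<open>Every piece lies inside \<open>\<Union>\<K>\<close>, which the points of
      \<open>R\<close> avoid.\<close>
    moreover have "x \<notin> P (x', n)" "x' \<notin> P (x, n)" for n
      using PK[OF J(1)[of n]] PK[OF J(2)[of n]] x by (auto simp: R_def)
    ultimately show "L x \<inter> L x' = {}" using x(3) by (auto simp: L_def)
  qed
  have UL: "(\<Union>x\<in>R. L x) = R \<union> (\<Union>p\<in>J. P p)"
    by (auto simp: L_def J_def)

  \<comment> \<open>Assembling the partition\<close>
  have "cantor_partition_on X (\<Union>x\<in>R. L x)"
    using disL L_image by (intro cantor_partition_on_UN cantor_image_imp_partition_on)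
  then have "cantor_partition_on X ((\<Union>x\<in>R. L x) \<union> (\<Union>\<K> - (\<Union>p\<in>J. P p)))"
    unfolding UL using rest by (rule cantor_partition_on_Un) (auto simp: R_def)
  moreover have "(\<Union>x\<in>R. L x) \<union> (\<Union>\<K> - (\<Union>p\<in>J. P p)) = topspace X"
  proof -
    have "\<Union>\<K> \<subseteq> topspace X" using cantor_image_subset[OF \<K>(2)] by blast
    moreover have "(\<Union>p\<in>J. P p) \<subseteq> \<Union>\<K>" using PK by (rule UN_least)
    \<comment> \<open>To be read with \<open>T\<close> the space, \<open>B\<close> the union of
      \<open>\<K>\<close> and \<open>A\<close> the union of the pieces, so that \<open>T - B\<close>
      is \<open>R\<close>.\<close>
    moreover have "(T - B \<union> A) \<union> (B - A) = T" if "B \<subseteq> T" "A \<subseteq> B" for A B T :: "'a set"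
      using that by blast
    ultimately show ?thesis unfolding UL unfolding R_def by simp
  qed
  ultimately show ?thesis by simp
qed

theorem theorem2p3:
  fixes X :: "'a topology"
  assumes "first_countable X"
    and "Hausdorff_space X"
    and "topspace X \<lesssim> (UNIV :: (nat \<Rightarrow> bool) set)"
  shows "cantor_partitionable X \<longleftrightarrow> cantor_coverable X"
proof
  assume "cantor_partitionable X"
  then show "cantor_coverable X"
    unfolding cantor_partitionable_def cantor_coverable_def by (metis partition_onD1)
next
  assume "cantor_coverable X"
  then show "cantor_partitionable X"
    using cantor_coverable_imp_partition_on[OF assms(1,3)] assms(2)
    by (simp add: cantor_partitionable_iff cantor_coverable_iff)
qed

end
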